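(* Consider a static planar ($\kappa=0$) black hole metric in $d+2$ dimensions (as in the context) solving Einstein's equations $G_{\mu\nu}+\Lambda g_{\mu\nu}=8\pi G_NT_{\mu\nu}$ with $G_N>0$, and suppose the Null Energy Condition holds: $T_{\mu\nu}k^\mu k^\nu\ge0$ for all null vectors $k^\mu$. Then the pole-skipping values $\mu_{11}$ and $\mu_{21},\mu_{22}$ of a massless scalar at orders $1$ and $2$ satisfy $$4\mu_{11}^2+d\,(2\mu_{11}-\mu_{21})(2\mu_{11}-\mu_{22})\ge0 .$$
   Context: Metric: $ds^2=\frac1{z^2}\big(-f_1(z)dt^2+\frac{dz^2}{f_2(z)}+\sum_{i=1}^d dx_i^2\big)$, horizon at $z=1$; $f_1,f_2$ are real analytic near $z=1$, $f_1(1)=f_2(1)=0$, $f_1'(1)f_2'(1)=(4\pi T)^2$ with $T>0$ the Hawking temperature. A massless scalar $\Phi=e^{-i\omega t+i\vec q\cdot\vec x}\psi(z)$ with $\mu=\vec q^{\,2}$ (treated as a complex variable) satisfies $A\psi''+B\psi'+C\psi=0$ with $A=f_1f_2$, $B=\frac12(f_1f_2)'-\frac{d}{z}f_1f_2$, $C=\omega^2-\mu f_1$. Write $A_j,B_j,C_j$ for the coefficients of $(z-1)^j$ (zero for $j<0$). Put $\rho=-i\omega/(4\pi T)$ (ingoing exponent) and $$M_{KS}=A_{K-S+3}(\rho+S-1)(\rho+S-2)+B_{K-S+2}(\rho+S-1)+C_{K-S+1},$$ the coefficient of $\phi_{S-1}$ at order $(z-1)^{\rho+K}$ when $\psi=(z-1)^\rho\sum_j\phi_j(z-1)^j$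 is inserted. At $\omega=\omega_n=-2\pi iTn$ (so $\rho=-n/2$), $\det(M_{KS})_{1\le K,S\le n}$ is a polynomial of degree $n$ in $\mu$ with roots $\mu_{n1},\dots,\mu_{nn}$ (with multiplicity, possibly complex): the order-$n$ pole-skipping values. *)

theory Defs
  imports "HOL-Analysis.Analysis" "HOL-Library.Nonpos_Ints" "Jordan_Normal_Form.Determinant"
begin

(* "$", "\<bullet>", "det", "mat" are claimed by both matrix libraries: the infixes are kept for
   HOL-Analysis (spacetime tensors), Jordan_Normal_Form is referred to by qualified names. *)
no_notation Matrix.vec_index (infixl \<open>$\<close> 100)
no_notation Matrix.scalar_prod (infix \<open>\<bullet>\<close> 70)

section \<open>Curvature of a metric in one coordinate chart\<close>

definition partial_deriv :: "'n \<Rightarrow> (real ^ 'n \<Rightarrow> real) \<Rightarrow> real ^ 'n::finite \<Rightarrow> real" where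
  "partial_deriv i F x = deriv (\<lambda>s. F (x + s *\<^sub>R axis i 1)) 0"

definition christoffel ::
  "(real ^ 'n \<Rightarrow> real ^ 'n ^ 'n) \<Rightarrow> 'n \<Rightarrow> 'n \<Rightarrow> 'n \<Rightarrow> real ^ 'n::finite \<Rightarrow> real" where
  "christoffel g a b c x =
     (\<Sum>e\<in>UNIV. matrix_inv (g x) $ a $ e *
        (partial_deriv b (\<lambda>y. g y $ e $ c) x + partial_deriv c (\<lambda>y. g y $ e $ b) x
         - partial_deriv e (\<lambda>y. g y $ b $ c) x)) / 2"

(* riemann g r s m n is R^r_{s m n}, with the sign for which round spheres have positive
   scalar curvature. *)
definition riemann ::
  "(real ^ 'n \<Rightarrow> real ^ 'n ^ 'n) \<Rightarrow> 'n \<Rightarrow> 'n \<Rightarrow> 'n \<Rightarrow> 'n \<Rightarrow> real ^ 'n::finite \<Rightarrow> real" where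
  "riemann g r s m n x =
     partial_deriv m (christoffel g r n s) x - partial_deriv n (christoffel g r m s) x
     + (\<Sum>l\<in>UNIV. christoffel g r m l x * christoffel g l n s x)
     - (\<Sum>l\<in>UNIV. christoffel g r n l x * christoffel g l m s x)"

definition ricci ::
  "(real ^ 'n \<Rightarrow> real ^ 'n ^ 'n) \<Rightarrow> real ^ 'n::finite \<Rightarrow> real ^ 'n ^ 'n" where
  "ricci g x = (\<chi> s n. \<Sum>r\<in>UNIV. riemann g r s r n x)"

definition scalar_curvature ::
  "(real ^ 'n \<Rightarrow> real ^ 'n ^ 'n) \<Rightarrow> real ^ 'n::finite \<Rightarrow> real" where
  "scalar_curvature g x = (\<Sum>a\<in>UNIV. \<Sum>b\<in>UNIV. matrix_inv (g x) $ a $ b * ricci g x $ a $ b)"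

definition einstein_tensor ::
  "(real ^ 'n \<Rightarrow> real ^ 'n ^ 'n) \<Rightarrow> real ^ 'n::finite \<Rightarrow> real ^ 'n ^ 'n" where
  "einstein_tensor g x = ricci g x - (scalar_curvature g x / 2) *\<^sub>R g x"

definition null_vector :: "real ^ 'n ^ 'n \<Rightarrow> real ^ 'n::finite \<Rightarrow> bool" where
  "null_vector G k \<longleftrightarrow> k \<bullet> (G *v k) = 0"

definition einstein_equations_on ::
  "(real ^ 'n::finite) set \<Rightarrow> (real ^ 'n \<Rightarrow> real ^ 'n ^ 'n) \<Rightarrow> real \<Rightarrow> real
     \<Rightarrow> (real ^ 'n \<Rightarrow> real ^ 'n ^ 'n) \<Rightarrow> bool" where
  "einstein_equations_on U g \<Lambda> G\<^sub>N Tmn \<longleftrightarrow>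
     (\<forall>x\<in>U. einstein_tensor g x + \<Lambda> *\<^sub>R g x = (8 * pi * G\<^sub>N) *\<^sub>R Tmn x)"

definition null_energy_condition_on ::
  "(real ^ 'n::finite) set \<Rightarrow> (real ^ 'n \<Rightarrow> real ^ 'n ^ 'n)
     \<Rightarrow> (real ^ 'n \<Rightarrow> real ^ 'n ^ 'n) \<Rightarrow> bool" where
  "null_energy_condition_on U g Tmn \<longleftrightarrow>
     (\<forall>x\<in>U. \<forall>k. null_vector (g x) k \<longrightarrow> k \<bullet> (Tmn x *v k) \<ge> 0)"

section \<open>The static planar black hole\<close>

(* Coordinate labels of the (d+2)-dimensional spacetime, with d = CARD('d). *)
datatype 'd coord = Time | Radial | Space 'd

instance coord :: (finite) finite
proof
  have "(UNIV :: 'a coord set) = {Time, Radial} \<union> range Space"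
    by (auto intro: coord.exhaust)
  then show "finite (UNIV :: 'a coord set)"
    by (metis finite finite_Un finite_imageI finite.emptyI finite.insertI)
qed

definition planar_metric ::
  "(real \<Rightarrow> real) \<Rightarrow> (real \<Rightarrow> real) \<Rightarrow> real ^ ('d::finite coord)
     \<Rightarrow> real ^ ('d coord) ^ ('d coord)" where
  "planar_metric f1 f2 x =
     (let z = x $ Radial in
      \<chi> a b. if a \<noteq> b then 0
            else (case a of Time \<Rightarrow> - f1 z | Radial \<Rightarrow> 1 / f2 z | Space i \<Rightarrow> 1) / z\<^sup>2)"

definition exterior :: "real \<Rightarrow> (real ^ ('d::finite coord)) set" where
  "exterior z0 = {x. z0 < x $ Radial \<and> x $ Radial < 1}"

definition real_analytic_at :: "(real \<Rightarrow> real) \<Rightarrow> real \<Rightarrow> bool" where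
  "real_analytic_at f x \<longleftrightarrow>
     (\<exists>r>0. \<exists>a :: nat \<Rightarrow> real. \<forall>y. \<bar>y - x\<bar> < r \<longrightarrow> (\<lambda>n. a n * (y - x) ^ n) sums f y)"

section \<open>Pole-skipping values of a massless scalar\<close>

(* Coefficient of (z-1)^j in the Taylor expansion of F at the horizon z = 1. *)
definition horizon_coeff :: "(real \<Rightarrow> complex) \<Rightarrow> int \<Rightarrow> complex" where
  "horizon_coeff F j =
     (if j < 0 then 0
      else (((\<lambda>G x. vector_derivative G (at x)) ^^ nat j) F) 1 / fact (nat j))"

(* The radial equation A psi'' + B psi' + C psi = 0 is the massless Klein-Gordon equation
   for exp(-i omega t + i q.x) psi(z) in the metric above, with mu = q^2. *)
definition wave_A :: "(real \<Rightarrow> real) \<Rightarrow> (real \<Rightarrow> real) \<Rightarrow> real \<Rightarrow> complex" where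
  "wave_A f1 f2 z = complex_of_real (f1 z * f2 z)"

definition wave_B :: "nat \<Rightarrow> (real \<Rightarrow> real) \<Rightarrow> (real \<Rightarrow> real) \<Rightarrow> real \<Rightarrow> complex" where
  "wave_B d f1 f2 z =
     complex_of_real (deriv (\<lambda>y. f1 y * f2 y) z / 2 - real d / z * (f1 z * f2 z))"

definition wave_C :: "(real \<Rightarrow> real) \<Rightarrow> complex \<Rightarrow> complex \<Rightarrow> real \<Rightarrow> complex" where
  "wave_C f1 \<omega> \<mu> z = \<omega>\<^sup>2 - \<mu> * complex_of_real (f1 z)"

definition ingoing_exponent :: "real \<Rightarrow> complex \<Rightarrow> complex" where
  "ingoing_exponent T \<omega> = - \<i> * \<omega> / complex_of_real (4 * pi * T)"

(* Coefficient of phi_{S-1} at order (z-1)^(rho+K) on inserting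
   psi = (z-1)^rho * (sum_j phi_j (z-1)^j) into the radial equation; K, S count from 1. *)
definition frobenius_M ::
  "nat \<Rightarrow> (real \<Rightarrow> real) \<Rightarrow> (real \<Rightarrow> real) \<Rightarrow> real \<Rightarrow> complex \<Rightarrow> complex \<Rightarrow> nat \<Rightarrow> nat \<Rightarrow> complex" where
  "frobenius_M d f1 f2 T \<omega> \<mu> K S =
     (let \<rho> = ingoing_exponent T \<omega>; s = (of_nat S :: complex); j = int K - int S in
        horizon_coeff (wave_A f1 f2) (j + 3) * (\<rho> + s - 1) * (\<rho> + s - 2)
      + horizon_coeff (wave_B d f1 f2) (j + 2) * (\<rho> + s - 1)
      + horizon_coeff (wave_C f1 \<omega> \<mu>) (j + 1))"

definition pole_skipping_freq :: "real \<Rightarrow> nat \<Rightarrow> complex" where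
  "pole_skipping_freq T n = - 2 * complex_of_real pi * \<i> * complex_of_real T * of_nat n"

definition pole_skipping_det ::
  "nat \<Rightarrow> (real \<Rightarrow> real) \<Rightarrow> (real \<Rightarrow> real) \<Rightarrow> real \<Rightarrow> nat \<Rightarrow> complex \<Rightarrow> complex" where
  "pole_skipping_det d f1 f2 T n \<mu> =
     Determinant.det (Matrix.mat n n
       (\<lambda>(i, j). frobenius_M d f1 f2 T (pole_skipping_freq T n) \<mu> (i + 1) (j + 1)))"

(* The order-n pole-skipping values, as the multiset of roots (with multiplicity) of the
   determinant, which is a polynomial function of mu. *)
definition pole_skipping_values ::
  "nat \<Rightarrow> (real \<Rightarrow> real) \<Rightarrow> (real \<Rightarrow> real) \<Rightarrow> real \<Rightarrow> nat \<Rightarrow> complex multiset \<Rightarrow> bool" where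
  "pole_skipping_values d f1 f2 T n vals \<longleftrightarrow>
     (\<exists>P :: complex poly. P \<noteq> 0 \<and> (\<forall>\<mu>. poly P \<mu> = pole_skipping_det d f1 f2 T n \<mu>)
        \<and> proots P = vals)"

end

(* Write f1 = a1 h + a2 h^2 + ... and f2 = b1 h + b2 h^2 + ... with h = z - 1. The roots of the
   pole-skipping determinants give mu11 = d b1 / 2, and evaluating the order-2 determinant at
   2 mu11 turns the left-hand side into d^2 b1 (a1 b2 - a2 b1) / (2 a1), where a1 b1 > 0.
   On the other hand, contracting the Einstein equations with the two radial null vectors
   d_t / sqrt f1 +- sqrt f2 d_z (whose average has no mixed components) turns the null energy
   condition into f2' f1 - f1' f2 >= 0 outside the horizon. The leading term of this Wronskian is
   (a1 b2 - a2 b1) h^2, hence a1 b2 - a2 b1 >= 0. *)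
theory Submission
  imports Defs "HOL-Computational_Algebra.Fundamental_Theorem_Algebra"
begin

section \<open>Curvature of diagonal metrics depending on one coordinate\<close>

text \<open>\<open>deriv\<close> depends only on the germ of a function, so agreement on the open
  slab \<open>y $ c \<in> S\<close> suffices. The equality also holds where \<open>G\<close> is not
  differentiable, both sides then being the same arbitrary value.\<close>

lemma partial_deriv_one_variable:
  assumes "open S" "x $ c \<in> S" "\<And>y. y $ c \<in> S \<Longrightarrow> F y = G (y $ c)"
  shows "partial_deriv i F x = (if i = c then deriv G (x $ c) else 0)"
proof -
  have line: "(x + s *\<^sub>R axis i 1) $ c = x $ c + (if i = c then s else 0)" for s
    by (simp add: axis_def)
  have "((\<lambda>s. x $ c + s) \<longlongrightarrow> x $ c + 0) (nhds 0)"
    by (intro tendsto_intros filterlim_ident)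
  then have "eventually (\<lambda>s. x $ c + s \<in> S) (nhds 0)"
    using assms(1,2) by (auto dest: topological_tendstoD)
  then have ev: "eventually (\<lambda>s. F (x + s *\<^sub>R axis i 1) = G (x $ c + (if i = c then s else 0))) (nhds 0)"
    by eventually_elim (use assms line in \<open>auto simp del: vector_add_component\<close>)
  have "partial_deriv i F x = deriv (\<lambda>s. G (x $ c + (if i = c then s else 0))) 0"
    unfolding partial_deriv_def using ev by (rule deriv_cong_ev) simp
  also have "\<dots> = (if i = c then deriv G (x $ c) else 0)"
    using DERIV_shift[of G _ 0 "x $ c"]
    by (cases "i = c") (simp_all add: deriv_def[of G] deriv_def[of "\<lambda>s. G (s + x $ c)"] add.commute)
  finally show ?thesis .
qed

text \<open>\<open>matrix_inv\<close> is a choice term, so a two-sided inverse is exhibited first;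
  row \<open>a\<close> of the product of \<open>A\<close> with \<open>matrix_inv A\<close> then
  determines the entries.\<close>

lemma matrix_inv_diagonal:
  fixes A :: "real ^ 'n ^ 'n::finite"
  assumes diag: "\<And>a b. A $ a $ b = (if a = b then u a else 0)" and nz: "\<And>a. u a \<noteq> 0"
  shows "matrix_inv A $ a $ b = (if a = b then inverse (u a) else 0)"
proof -
  have "\<exists>B. A ** B = Finite_Cartesian_Product.mat 1 \<and> B ** A = Finite_Cartesian_Product.mat 1"
    by (intro exI[of _ "\<chi> a b. if a = b then inverse (u a) else 0"])
       (auto simp: fun_eq_iff vec_eq_iff matrix_matrix_mult_def Finite_Cartesian_Product.mat_def diag nz
             if_distrib[of "\<lambda>x. x * _"] cong: if_cong)
  then have "A ** matrix_inv A = Finite_Cartesian_Product.mat 1"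
    unfolding matrix_inv_def by (rule someI2_ex) blast
  then have "(A ** matrix_inv A) $ a $ b = (if a = b then 1 else 0)"
    by (simp add: Finite_Cartesian_Product.mat_def)
  then have "u a * matrix_inv A $ a $ b = (if a = b then 1 else 0)"
    by (simp add: matrix_matrix_mult_def diag if_distrib[of "\<lambda>x. x * _"] cong: if_cong)
  then show ?thesis
    using nz[of a] by (cases "a = b") (simp_all add: inverse_unique)
qed

text \<open>Invertibility is imposed only over an open set \<open>S\<close> of values of coordinate
  \<open>c\<close>, because the black hole metric degenerates at the horizon. The curvature formulas
  are identities between \<open>deriv\<close> terms, so smoothness enters only once the scale
  functions are explicit.\<close>

locale one_variable_diagonal_metric =
  fixes g :: "real ^ 'n \<Rightarrow> real ^ 'n ^ 'n::finite"
    and \<phi> :: "'n \<Rightarrow> real \<Rightarrow> real" and c :: 'n and S :: "real set"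
  assumes metric: "\<And>x a b. g x $ a $ b = (if a = b then \<phi> a (x $ c) else 0)"
    and open_S: "open S"
    and nonzero: "\<And>a z. z \<in> S \<Longrightarrow> \<phi> a z \<noteq> 0"
begin

(* The nonzero Christoffel symbols: L a is the symbol (a; a c) = (a; c a), and N b is (c; b b)
   for b other than c. *)
definition L :: "'n \<Rightarrow> real \<Rightarrow> real" where
  "L a z = deriv (\<phi> a) z / (2 * \<phi> a z)"

definition N :: "'n \<Rightarrow> real \<Rightarrow> real" where
  "N a z = - deriv (\<phi> a) z / (2 * \<phi> c z)"

text \<open>For \<open>a = b = d = c\<close> both index patterns match and the first branch must
  win: the three metric derivatives then combine to \<open>L c\<close>, whereas \<open>N c\<close>
  is its negative. Values are functions of z so that they can be differentiated again.\<close>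

definition Gam :: "'n \<Rightarrow> 'n \<Rightarrow> 'n \<Rightarrow> real \<Rightarrow> real" where
  "Gam a b d = (if a = d \<and> b = c \<or> a = b \<and> d = c then L a else if a = c \<and> b = d then N b else (\<lambda>_. 0))"

lemma partial_deriv_metric:
  "partial_deriv i (\<lambda>y. g y $ a $ b) x = (if i = c \<and> a = b then deriv (\<phi> a) (x $ c) else 0)"
proof -
  have "partial_deriv i (\<lambda>y. g y $ a $ b) x
      = (if i = c then deriv (if a = b then \<phi> a else (\<lambda>_. 0)) (x $ c) else 0)"
    by (rule partial_deriv_one_variable[of UNIV]) (auto simp: metric)
  then show ?thesis by simp
qed

lemma christoffel_eq:
  assumes "x $ c \<in> S"
  shows "christoffel g a b d x = Gam a b d (x $ c)"
proof -
  have "matrix_inv (g x) $ a $ e = (if a = e then inverse (\<phi> a (x $ c)) else 0)" for e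
    by (rule matrix_inv_diagonal) (use assms in \<open>auto simp: metric nonzero\<close>)
  then have "christoffel g a b d x = inverse (\<phi> a (x $ c)) *
     ((if b = c \<and> a = d then deriv (\<phi> a) (x $ c) else 0) + (if d = c \<and> a = b then deriv (\<phi> a) (x $ c) else 0)
      - (if a = c \<and> b = d then deriv (\<phi> b) (x $ c) else 0)) / 2"
    unfolding christoffel_def partial_deriv_metric
    by (simp add: if_distrib[of "\<lambda>x. x * _"] cong: if_cong)
  then show ?thesis
    by (cases "a = d"; cases "b = c"; cases "a = b"; cases "d = c"; cases "a = c"; cases "b = d")
       (simp_all add: Gam_def L_def N_def inverse_eq_divide)
qed

lemma partial_deriv_christoffel:
  assumes "x $ c \<in> S"
  shows "partial_deriv i (christoffel g a b d) x = (if i = c then deriv (Gam a b d) (x $ c) else 0)"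
  using open_S assms christoffel_eq by (rule partial_deriv_one_variable)

lemma riemann_eq:
  assumes "x $ c \<in> S"
  shows "riemann g r s r s x =
    (if r = c then deriv (Gam r s s) (x $ c) else 0) - (if s = c then deriv (Gam r r s) (x $ c) else 0)
    + (\<Sum>l\<in>UNIV. Gam r r l (x $ c) * Gam l s s (x $ c))
    - (\<Sum>l\<in>UNIV. Gam r s l (x $ c) * Gam l r s (x $ c))"
  by (simp add: riemann_def christoffel_eq partial_deriv_christoffel assms)

text \<open>Since \<open>s\<close> differs from \<open>c\<close>, the only symbol with both lower
  indices \<open>s\<close> is \<open>N s\<close>. The second quadratic sum contributes
  \<open>L s * N s\<close> twice, once for \<open>r = s\<close> and once for \<open>r = c\<close>,
  whence the \<open>- 2 * L s\<close>.\<close>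

lemma ricci_transverse:
  assumes x: "x $ c \<in> S" and s: "s \<noteq> c"
  shows "ricci g x $ s $ s =
    deriv (N s) (x $ c) + N s (x $ c) * ((\<Sum>r\<in>UNIV. L r (x $ c)) - 2 * L s (x $ c))"
proof -
  define z where "z = x $ c"
  have 1: "(\<Sum>l\<in>UNIV. Gam r r l z * Gam l s s z) = L r z * N s z" for r
  proof -
    have "(\<Sum>l\<in>UNIV. Gam r r l z * Gam l s s z) = (\<Sum>l\<in>UNIV. if l = c then L r z * N s z else 0)"
      using s by (intro sum.cong) (auto simp: Gam_def)
    then show ?thesis by simp
  qed
  have 2: "(\<Sum>l\<in>UNIV. Gam r s l z * Gam l r s z)
      = (if r = s then L s z * N s z else 0) + (if r = c then L s z * N s z else 0)" for r
  proof -
    have "(\<Sum>l\<in>UNIV. Gam r s l z * Gam l r s z)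
      = (\<Sum>l\<in>UNIV. (if l = c then if r = s then L s z * N s z else 0 else 0)
                  + (if l = s then if r = c then L s z * N s z else 0 else 0))"
      using s by (intro sum.cong) (auto simp: Gam_def)
    then show ?thesis by (simp add: sum.distrib)
  qed
  have 3: "(if r = c then deriv (Gam r s s) z else 0) = (if r = c then deriv (N s) z else 0)" for r
    using s by (simp add: Gam_def)
  have "ricci g x $ s $ s = (\<Sum>r\<in>UNIV. (if r = c then deriv (N s) z else 0) + L r z * N s z
     - ((if r = s then L s z * N s z else 0) + (if r = c then L s z * N s z else 0)))"
    by (simp add: ricci_def riemann_eq[OF x, folded z_def] 1 2 3 s)
  also have "\<dots> = deriv (N s) z + (\<Sum>r\<in>UNIV. L r z) * N s z - 2 * (L s z * N s z)"
    by (simp add: sum.distrib sum_subtractf sum_distrib_right)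
  finally show ?thesis by (simp add: z_def algebra_simps)
qed

text \<open>The summand \<open>r = c\<close> equals minus the derivative of \<open>L c\<close> and
  cancels the leading term. Hence no second derivative of the radial metric component
  survives.\<close>

lemma ricci_longitudinal:
  assumes x: "x $ c \<in> S"
  shows "ricci g x $ c $ c = deriv (L c) (x $ c)
    + (\<Sum>r\<in>UNIV. L r (x $ c) * L c (x $ c) - deriv (L r) (x $ c) - (L r (x $ c))\<^sup>2)"
proof -
  define z where "z = x $ c"
  have 1: "(\<Sum>l\<in>UNIV. Gam r r l z * Gam l c c z) = L r z * L c z" for r
  proof -
    have "(\<Sum>l\<in>UNIV. Gam r r l z * Gam l c c z) = (\<Sum>l\<in>UNIV. if l = c then L r z * L c z else 0)"
      by (intro sum.cong) (auto simp: Gam_def)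
    then show ?thesis by simp
  qed
  have 2: "(\<Sum>l\<in>UNIV. Gam r c l z * Gam l r c z) = (L r z)\<^sup>2" for r
  proof -
    have "(\<Sum>l\<in>UNIV. Gam r c l z * Gam l r c z) = (\<Sum>l\<in>UNIV. if l = r then (L r z)\<^sup>2 else 0)"
      by (intro sum.cong) (auto simp: Gam_def power2_eq_square)
    then show ?thesis by simp
  qed
  have 3: "(if r = c then deriv (Gam r c c) z else 0) = (if r = c then deriv (L c) z else 0)"
    "Gam r r c = L r" for r
    by (simp_all add: Gam_def)
  have "ricci g x $ c $ c = (\<Sum>r\<in>UNIV. (if r = c then deriv (L c) z else 0)
     + (L r z * L c z - deriv (L r) z - (L r z)\<^sup>2))"
    by (simp add: ricci_def riemann_eq[OF x, folded z_def] 1 2 3 algebra_simps cong: if_cong)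
  also have "\<dots> = deriv (L c) z + (\<Sum>r\<in>UNIV. L r z * L c z - deriv (L r) z - (L r z)\<^sup>2)"
    by (simp only: sum.distrib) simp
  finally show ?thesis by (simp add: z_def)
qed

end

section \<open>Null contractions of the Einstein equations\<close>

text \<open>The scalar curvature and cosmological terms are multiples of the metric, so they vanish
  when contracted twice with a null vector.\<close>

lemma ricci_null_nonneg:
  assumes eq: "einstein_equations_on U g \<Lambda> G\<^sub>N Tmn" and nec: "null_energy_condition_on U g Tmn"
    and "G\<^sub>N > 0" "x \<in> U" and null: "null_vector (g x) k"
  shows "k \<bullet> (ricci g x *v k) \<ge> 0"
proof -
  have "ricci g x = (8 * pi * G\<^sub>N) *\<^sub>R Tmn x + (scalar_curvature g x / 2 - \<Lambda>) *\<^sub>R g x"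
    using eq \<open>x \<in> U\<close> unfolding einstein_equations_on_def einstein_tensor_def
    by (auto simp: algebra_simps)
  then have "k \<bullet> (ricci g x *v k) = 8 * pi * G\<^sub>N * (k \<bullet> (Tmn x *v k))"
    using null unfolding null_vector_def
    by (simp add: matrix_vector_mult_add_rdistrib scaleR_matrix_vector_assoc[symmetric] inner_add_right)
  then show ?thesis
    using nec \<open>x \<in> U\<close> null \<open>G\<^sub>N > 0\<close> unfolding null_energy_condition_on_def by simp
qed

lemma quadratic_form_two_axes:
  fixes A :: "real ^ 'n ^ 'n::finite"
  assumes "a \<noteq> b"
  shows "(\<alpha> *\<^sub>R axis a 1 + \<beta> *\<^sub>R axis b 1) \<bullet> (A *v (\<alpha> *\<^sub>R axis a 1 + \<beta> *\<^sub>R axis b 1))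
    = \<alpha>\<^sup>2 * A $ a $ a + \<beta>\<^sup>2 * A $ b $ b + \<alpha> * \<beta> * (A $ a $ b + A $ b $ a)"
proof -
  have "axis i 1 \<bullet> (A *v axis j 1) = A $ i $ j" for i j
    by (simp add: inner_axis_axis inner_axis' matrix_vector_mult_basis column_def)
  then show ?thesis
    by (simp add: matrix_vector_right_distrib matrix_vector_mult_scaleR inner_add_left inner_add_right
        power2_eq_square algebra_simps)
qed

lemma (in one_variable_diagonal_metric) ricci_null_plane:
  assumes eq: "einstein_equations_on U g \<Lambda> G\<^sub>N Tmn" and nec: "null_energy_condition_on U g Tmn"
    and "G\<^sub>N > 0" "x \<in> U" "a \<noteq> b"
    and null: "\<alpha>\<^sup>2 * \<phi> a (x $ c) + \<beta>\<^sup>2 * \<phi> b (x $ c) = 0"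
  shows "\<alpha>\<^sup>2 * ricci g x $ a $ a + \<beta>\<^sup>2 * ricci g x $ b $ b \<ge> 0"
proof -
  have "0 \<le> \<alpha>\<^sup>2 * ricci g x $ a $ a + \<gamma>\<^sup>2 * ricci g x $ b $ b
      + \<alpha> * \<gamma> * (ricci g x $ a $ b + ricci g x $ b $ a)" if "\<gamma>\<^sup>2 = \<beta>\<^sup>2" for \<gamma>
  proof -
    have "null_vector (g x) (\<alpha> *\<^sub>R axis a 1 + \<gamma> *\<^sub>R axis b 1)"
      using null \<open>a \<noteq> b\<close> that
      by (simp add: null_vector_def quadratic_form_two_axes metric)
    from ricci_null_nonneg[OF eq nec \<open>G\<^sub>N > 0\<close> \<open>x \<in> U\<close> this] show ?thesis
      by (simp only: quadratic_form_two_axes[OF \<open>a \<noteq> b\<close>])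
  qed
  \<comment> \<open>Adding the inequalities for the two signs removes the off-diagonal Ricci
    components without computing them.\<close>
  from this[of \<beta>] this[of "-\<beta>"] show ?thesis by simp
qed

section \<open>The null energy condition in the exterior\<close>

lemma sum_coord:
  "(\<Sum>r\<in>(UNIV :: 'd::finite coord set). F r) = F Time + F Radial + (\<Sum>i\<in>UNIV. F (Space i))"
proof -
  have "sum F (UNIV :: 'd coord set) = sum F (insert Time (insert Radial (range Space)))"
    by (rule arg_cong[where f = "sum F"]) (auto intro: coord.exhaust)
  moreover have "(\<Sum>r\<in>range Space. F r) = (\<Sum>i\<in>UNIV. F (Space i))"
    by (subst sum.reindex) (auto intro: inj_onI)
  ultimately show ?thesis
    by (simp add: add.assoc image_iff)
qed

text \<open>The conclusion says that f2 / f1 has nonnegative derivative on \<open>S\<close>, the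
  geometric content of the null energy condition in the radial directions.\<close>

lemma planar_radial_nec:
  fixes Tmn :: "real ^ ('d::finite coord) \<Rightarrow> real ^ ('d coord) ^ ('d coord)"
  assumes z0: "0 \<le> z0" and S: "open S" "S \<subseteq> {z0<..<1}"
    and pos: "\<And>z. z \<in> S \<Longrightarrow> f1 z > 0" "\<And>z. z \<in> S \<Longrightarrow> f2 z > 0"
    and f1': "\<And>z. z \<in> S \<Longrightarrow> (f1 has_real_derivative f1' z) (at z)"
    and f1'': "\<And>z. z \<in> S \<Longrightarrow> (f1' has_real_derivative f1'' z) (at z)"
    and f2': "\<And>z. z \<in> S \<Longrightarrow> (f2 has_real_derivative f2' z) (at z)"
    and G: "G\<^sub>N > 0"
    and einstein: "einstein_equations_on (exterior z0) (planar_metric f1 f2) \<Lambda> G\<^sub>N Tmn"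
    and nec: "null_energy_condition_on (exterior z0) (planar_metric f1 f2) Tmn"
    and z: "z \<in> S"
  shows "f1' z * f2 z \<le> f2' z * f1 z"
proof -
  have S_pos: "w > 0" if "w \<in> S" for w
    using S z0 that by force
  define \<phi> :: "'d coord \<Rightarrow> real \<Rightarrow> real" where
    "\<phi> a w = (case a of Time \<Rightarrow> - f1 w | Radial \<Rightarrow> 1 / f2 w | Space i \<Rightarrow> 1) / w\<^sup>2" for a w
  interpret one_variable_diagonal_metric "planar_metric f1 f2" \<phi> Radial S
  proof
    show "\<phi> a w \<noteq> 0" if "w \<in> S" for a w
      using that S_pos[of w] pos[of w] by (auto simp: \<phi>_def split: coord.split)
  qed (use S in \<open>auto simp: planar_metric_def \<phi>_def Let_def\<close>)
  note nz = pos(1)[THEN less_imp_neq] pos(2)[THEN less_imp_neq] S_pos[THEN less_imp_neq]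
  have \<phi>_deriv: "deriv (\<phi> Time) w = - f1' w / w\<^sup>2 + 2 * f1 w / w ^ 3"
    "deriv (\<phi> Radial) w = - f2' w / ((f2 w)\<^sup>2 * w\<^sup>2) - 2 / (f2 w * w ^ 3)"
    "deriv (\<phi> (Space i)) w = - 2 / w ^ 3" if "w \<in> S" for w i
    unfolding \<phi>_def coord.case
    by (rule DERIV_imp_deriv;
        use nz[OF that] in \<open>auto intro!: derivative_eq_intros f1'[OF that] f2'[OF that]
          simp: field_simps power2_eq_square power3_eq_cube\<close>)+
  have L_eq: "L Time w = f1' w / (2 * f1 w) - 1 / w"
    "L Radial w = - f2' w / (2 * f2 w) - 1 / w" "L (Space i) w = - 1 / w"
    "N Time w = f2 w * (f1' w / 2 - f1 w / w)" if "w \<in> S" for w i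
    unfolding L_def N_def \<phi>_deriv[OF that] using nz[OF that]
    by (auto simp: \<phi>_def field_simps power2_eq_square power3_eq_cube)
  have L_deriv: "deriv (L Time) z = (f1'' z * f1 z - (f1' z)\<^sup>2) / (2 * (f1 z)\<^sup>2) + 1 / z\<^sup>2"
    "deriv (L (Space i)) z = 1 / z\<^sup>2"
    "deriv (N Time) z = f2' z * (f1' z / 2 - f1 z / z) + f2 z * (f1'' z / 2 - f1' z / z + f1 z / z\<^sup>2)" for i
  proof -
    have "((\<lambda>w. f1' w / (2 * f1 w) - 1 / w) has_real_derivative
        (f1'' z * f1 z - (f1' z)\<^sup>2) / (2 * (f1 z)\<^sup>2) + 1 / z\<^sup>2) (at z)"
      using nz[OF z] by (auto intro!: derivative_eq_intros f1'[OF z] f1''[OF z]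
          simp: field_simps power2_eq_square)
    then show "deriv (L Time) z = (f1'' z * f1 z - (f1' z)\<^sup>2) / (2 * (f1 z)\<^sup>2) + 1 / z\<^sup>2"
      by (intro DERIV_imp_deriv) (rule has_field_derivative_transform_within_open[OF _ S(1) z], auto simp: L_eq)
    have "((\<lambda>w. - 1 / w) has_real_derivative 1 / z\<^sup>2) (at z)"
      using nz[OF z] by (auto intro!: derivative_eq_intros simp: field_simps power2_eq_square)
    then show "deriv (L (Space i)) z = 1 / z\<^sup>2"
      by (intro DERIV_imp_deriv) (rule has_field_derivative_transform_within_open[OF _ S(1) z], auto simp: L_eq)
    have "((\<lambda>w. f2 w * (f1' w / 2 - f1 w / w)) has_real_derivative
        f2' z * (f1' z / 2 - f1 z / z) + f2 z * (f1'' z / 2 - f1' z / z + f1 z / z\<^sup>2)) (at z)"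
      using nz[OF z] by (auto intro!: derivative_eq_intros f1'[OF z] f1''[OF z] f2'[OF z]
          simp: field_simps power2_eq_square)
    then show "deriv (N Time) z = f2' z * (f1' z / 2 - f1 z / z) + f2 z * (f1'' z / 2 - f1' z / z + f1 z / z\<^sup>2)"
      by (intro DERIV_imp_deriv) (rule has_field_derivative_transform_within_open[OF _ S(1) z], auto simp: L_eq)
  qed
  \<comment> \<open>Any point with radial coordinate z serves, as the metric depends on that
    coordinate alone; all coordinates are set to z.\<close>
  define x :: "real ^ ('d coord)" where "x = (\<chi> i. z)"
  have x: "x $ Radial = z" "x $ Radial \<in> S" "x \<in> exterior z0"
    using z S(2) by (auto simp: x_def exterior_def)
  define d where "d = real CARD('d)"
  \<comment> \<open>Half the logarithmic derivatives of f1 and f2. Divided by the positive quantity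
    2 f1 f2, the claim reads lt \<le> lr.\<close>
  define lt where "lt = f1' z / (2 * f1 z)"
  define lr where "lr = f2' z / (2 * f2 z)"
  have f': "f1' z = 2 * f1 z * lt" "f2' z = 2 * f2 z * lr"
    using nz[OF z] by (simp_all add: lt_def lr_def)
  have tt: "ricci (planar_metric f1 f2) x $ Time $ Time =
      deriv (N Time) z + N Time z * (L Radial z - L Time z - d / z)"
    using ricci_transverse[OF x(2), of Time] by (simp add: x sum_coord L_eq[OF z] d_def)
  have rr: "ricci (planar_metric f1 f2) x $ Radial $ Radial =
      L Time z * L Radial z - deriv (L Time) z - (L Time z)\<^sup>2
      + d * (- L Radial z / z - 2 / z\<^sup>2)"
    using ricci_longitudinal[OF x(2)]
    by (simp add: x sum_coord L_eq(3)[OF z] L_deriv d_def power2_eq_square)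
  have "(1 / sqrt (f1 z))\<^sup>2 * \<phi> Time (x $ Radial) + (sqrt (f2 z))\<^sup>2 * \<phi> Radial (x $ Radial) = 0"
    using pos[OF z] by (simp add: \<phi>_def x power_divide)
  from ricci_null_plane[OF einstein nec G x(3) _ this]
  have "0 \<le> ricci (planar_metric f1 f2) x $ Time $ Time / f1 z
            + f2 z * ricci (planar_metric f1 f2) x $ Radial $ Radial"
    using pos[OF z] by (simp add: power_divide)
  \<comment> \<open>The terms free of d form the Ricci tensor of the two-dimensional t-z metric, a
    multiple of that metric, and so drop out on null vectors together with f1''. Only the spatial
    warp factor contributes.\<close>
  also have "\<dots> = d * f2 z / z * (lr - lt)"
    unfolding tt rr L_deriv L_eq[OF z] f' using nz[OF z]
    by (simp add: field_simps power2_eq_square)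
  finally have "0 \<le> d * f2 z / z * (lr - lt)" .
  \<comment> \<open>Types are inhabited, so there is at least one spatial direction and d is
    positive.\<close>
  moreover have "0 < d * f2 z / z"
    using pos[OF z] S_pos[OF z] by (simp add: d_def)
  ultimately have "lt \<le> lr"
    using zero_le_mult_iff[of "d * f2 z / z" "lr - lt"] by linarith
  then show ?thesis
    unfolding f' using pos[OF z] by (simp add: mult_left_mono mult.commute mult.left_commute)
qed

section \<open>Power series at the horizon\<close>

lemma real_analytic_at_imp_has_fps_expansion:
  assumes "real_analytic_at f x"
  obtains F where "(\<lambda>h. f (x + h)) has_fps_expansion F"
proof -
  from assms obtain r a where r: "r > 0"
    and a: "\<And>y. \<bar>y - x\<bar> < r \<Longrightarrow> (\<lambda>n. a n * (y - x) ^ n) sums f y"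
    unfolding real_analytic_at_def by blast
  have "eventually (\<lambda>u. u \<in> ball 0 r) (nhds (0::real))"
    using r by (intro eventually_nhds_in_open) auto
  then have "(\<lambda>h. f (x + h)) has_fps_expansion Abs_fps a"
    by (intro has_fps_expansionI, elim eventually_mono)
       (use a[of "x + _"] in \<open>simp add: dist_norm\<close>)
  then show thesis ..
qed

lemma has_fps_expansion_at_0: "f has_fps_expansion F \<Longrightarrow> f 0 = fps_nth F 0"
  unfolding has_fps_expansion_def by (auto dest!: eventually_nhds_x_imp_x simp: eval_fps_at_0)

text \<open>Agreement with the series near 0 is also agreement near each point close to 0, so the
  termwise derivative is valid on a whole neighbourhood. The curvature computation takes place at
  such points, away from the horizon.\<close>

lemma has_fps_expansion_imp_has_field_derivative:
  assumes "f has_fps_expansion F"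
  shows "eventually (\<lambda>z. (f has_field_derivative deriv f z) (at z)) (nhds 0)"
proof -
  have "eventually (\<lambda>z. z \<in> eball 0 (fps_conv_radius F)) (nhds 0)"
    using assms by (intro eventually_nhds_in_open) (auto simp: has_fps_expansion_def zero_ereal_def)
  moreover have "eventually (\<lambda>z. eventually (\<lambda>w. eval_fps F w = f w) (nhds z)) (nhds 0)"
    using assms by (simp add: has_fps_expansion_def eventually_eventually)
  ultimately show ?thesis
  proof eventually_elim
    case (elim z)
    have "(eval_fps F has_field_derivative eval_fps (fps_deriv F) z) (at z)"
      using elim(1) by (intro has_field_derivative_eval_fps) simp
    then have "(f has_field_derivative eval_fps (fps_deriv F) z) (at z)"
      using elim(2) by (simp add: DERIV_cong_ev)
    then show ?case
      by (simp add: DERIV_imp_deriv)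
  qed
qed

lemma has_fps_expansion_higher_deriv:
  "f has_fps_expansion F \<Longrightarrow> (deriv ^^ n) f has_fps_expansion (fps_deriv ^^ n) F"
  by (induction n) (auto intro: has_fps_expansion_deriv)

lemma eventually_nhds_shift:
  fixes a b :: real
  assumes "eventually P (nhds (a - b))"
  shows "eventually (\<lambda>z. P (z - b)) (nhds a)"
proof -
  have "filterlim (\<lambda>z. z - b) (nhds (a - b)) (nhds a)"
    by (intro tendsto_intros filterlim_ident)
  with assms show ?thesis by (rule eventually_compose_filterlim)
qed

lemma deriv_shift: "deriv f z = deriv (\<lambda>h. f (a + h)) (z - a)" for f :: "real \<Rightarrow> real"
  using DERIV_shift[of f _ "z - a" a] by (simp add: deriv_def add.commute)

lemma eventually_differentiable_near:
  fixes f :: "real \<Rightarrow> real"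
  assumes "(\<lambda>h. f (a + h)) has_fps_expansion F"
  shows "eventually (\<lambda>z. (f has_real_derivative deriv f z) (at z)) (nhds a)"
proof -
  have "eventually (\<lambda>z. ((\<lambda>h. f (a + h)) has_real_derivative deriv (\<lambda>h. f (a + h)) (z - a)) (at (z - a))) (nhds a)"
    using has_fps_expansion_imp_has_field_derivative[OF assms]
    by (intro eventually_nhds_shift[of _ a a]) simp
  then show ?thesis
    unfolding deriv_shift[of f _ a, symmetric]
    by eventually_elim (use DERIV_shift[of f _ "_ - a" a] in \<open>simp add: add.commute\<close>)
qed

text \<open>The coefficient is the left limit of w h / h^n, and an even power keeps the sign
  although h is negative.\<close>

lemma leading_even_coeff_nonneg:
  fixes w :: "real \<Rightarrow> real"
  assumes w: "w has_fps_expansion W" and low: "\<And>i. i < n \<Longrightarrow> fps_nth W i = 0" and "even n"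
    and nonneg: "eventually (\<lambda>h. w h \<ge> 0) (at_left 0)"
  shows "fps_nth W n \<ge> 0"
proof (cases "W = 0")
  case False
  define v where "v = (\<lambda>x. if x = 0 then fps_nth W n else w x / x ^ n)"
  \<comment> \<open>This bound is why \<open>W = 0\<close> is a separate case: the zero series has
    subdegree 0.\<close>
  have "n \<le> subdegree W"
    using False low by (intro subdegree_geI) auto
  then have "v has_fps_expansion fps_shift n W"
    unfolding v_def using w by (intro has_fps_expansion_shift) auto
  then have "continuous (at_left 0) v"
    by (rule has_fps_expansion_imp_continuous)
  then have "(v \<longlongrightarrow> fps_nth W n) (at_left 0)"
    by (simp add: continuous_within v_def)
  moreover have "eventually (\<lambda>x. x \<noteq> 0) (at_left (0::real))"
    by (simp add: eventually_at_filter)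
  with nonneg have "eventually (\<lambda>x. v x \<ge> 0) (at_left 0)"
    by eventually_elim (use \<open>even n\<close> in \<open>auto simp: v_def zero_le_even_power\<close>)
  ultimately show ?thesis
    by (rule tendsto_lowerbound) simp
qed simp

section \<open>Pole-skipping values of order one and two\<close>

text \<open>One form covers all three coefficients of the radial equation: \<open>wave_A\<close> and
  \<open>wave_B\<close> with c = 0 and k = 1, \<open>wave_C\<close> with c = \<omega>^2 and k =
  -\<mu>.\<close>

lemma horizon_coeff_affine:
  assumes g: "g has_fps_expansion G"
    and F: "\<And>z. F z = c + k * complex_of_real (g (z - 1))"
  shows "horizon_coeff F j =
    (if j < 0 then 0 else (if j = 0 then c else 0) + k * complex_of_real (fps_nth G (nat j)))"
proof -
  \<comment> \<open>The induction runs over germs, since the value at 1 alone does not determine the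
    next derivative.\<close>
  have "eventually (\<lambda>z. ((\<lambda>G x. vector_derivative G (at x)) ^^ n) F z
      = (if n = 0 then c else 0) + k * complex_of_real ((deriv ^^ n) g (z - 1))) (nhds 1)" for n
  proof (induction n)
    case 0
    then show ?case by (simp add: F)
  next
    case (Suc n)
    let ?h = "(deriv ^^ n) g" and ?c = "if n = 0 then c else 0"
    have "eventually (\<lambda>z. (?h has_field_derivative deriv ?h (z - 1)) (at (z - 1))) (nhds 1)"
      using has_fps_expansion_imp_has_field_derivative[OF has_fps_expansion_higher_deriv[OF g]]
      by (intro eventually_nhds_shift) simp
    moreover from Suc have "eventually (\<lambda>z. eventually (\<lambda>w.
        ((\<lambda>G x. vector_derivative G (at x)) ^^ n) F w = ?c + k * complex_of_real (?h (w - 1))) (nhds z)) (nhds 1)"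
      by (simp add: eventually_eventually)
    ultimately show ?case
    proof eventually_elim
      case (elim z)
      have "((\<lambda>w. ?h (w - 1)) has_field_derivative deriv ?h (z - 1)) (at z)"
        using elim(1) DERIV_shift[of ?h _ z "-1"] by simp
      then have "((\<lambda>w. ?c + k * complex_of_real (?h (w - 1))) has_vector_derivative
          k * complex_of_real (deriv ?h (z - 1))) (at z)"
        by (auto intro!: derivative_eq_intros)
      then have "vector_derivative (\<lambda>w. ?c + k * complex_of_real (?h (w - 1))) (at z)
          = k * complex_of_real (deriv ?h (z - 1))"
        by (rule vector_derivative_at)
      moreover have "vector_derivative (((\<lambda>G x. vector_derivative G (at x)) ^^ n) F) (at z)
          = vector_derivative (\<lambda>w. ?c + k * complex_of_real (?h (w - 1))) (at z)"
        using elim(2) by (intro vector_derivative_cong_eq) (auto elim: eventually_mono)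
      ultimately show ?case by simp
    qed
  qed
  from this[of "nat j", THEN eventually_nhds_x_imp_x] show ?thesis
    using has_fps_expansion_at_0[OF has_fps_expansion_higher_deriv[OF g]]
    by (auto simp: horizon_coeff_def fps_0th_higher_deriv add_divide_distrib)
qed

lemma det_two:
  assumes "A \<in> Matrix.carrier_mat 2 2"
  shows "Determinant.det A = A $$ (0,0) * A $$ (1,1) - A $$ (0,1) * A $$ (1,0)"
proof -
  have *: "Determinant.det (mat_delete A i 0) = A $$ (1 - i, 1)" if "i < 2" for i
    using assms that by (subst det_single) (auto simp: mat_delete_def less_2_cases_iff)
  have "Determinant.det A = (\<Sum>i<2. A $$ (i,0) * cofactor A i 0)"
    using laplace_expansion_column[OF assms, of 0] by simp
  also have "\<dots> = A $$ (0,0) * A $$ (1,1) - A $$ (0,1) * A $$ (1,0)"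
    by (simp add: numeral_2_eq_2 cofactor_def *[unfolded numeral_2_eq_2])
  finally show ?thesis .
qed

lemma poly_eq_prod_proots:
  "poly P x = lead_coeff P * (\<Prod>y\<in>#proots P. x - y)" for P :: "complex poly"
proof -
  have "poly P x = poly (Polynomial.smult (lead_coeff P) (\<Prod>y\<in>#proots P. [:-y, 1:])) x"
    by (simp only: complex_poly_decompose_multiset)
  then show ?thesis
    by (simp add: poly_prod_mset multiset.map_comp o_def)
qed

section \<open>The determinants and their roots in terms of horizon data\<close>

locale horizon_expansion =
  fixes d :: nat and f1 f2 :: "real \<Rightarrow> real" and F1 F2 :: "real fps" and T :: real
  assumes F1: "(\<lambda>h. f1 (1 + h)) has_fps_expansion F1"
    and F2: "(\<lambda>h. f2 (1 + h)) has_fps_expansion F2"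
    and horizon: "fps_nth F1 0 = 0" "fps_nth F2 0 = 0"
    and T: "T > 0" "fps_nth F1 1 * fps_nth F2 1 = (4 * pi * T)\<^sup>2"
begin

abbreviation "a1 \<equiv> fps_nth F1 1"
abbreviation "a2 \<equiv> fps_nth F1 2"
abbreviation "b1 \<equiv> fps_nth F2 1"
abbreviation "b2 \<equiv> fps_nth F2 2"

lemma A_nth:
  "fps_nth (F1 * F2) 0 = 0" "fps_nth (F1 * F2) 1 = 0" "fps_nth (F1 * F2) 2 = a1 * b1"
  "fps_nth (F1 * F2) 3 = a1 * b2 + a2 * b1"
  using horizon by (simp_all add: fps_mult_nth numeral_2_eq_2 numeral_3_eq_3)

lemma horizon_coeff_A:
  "horizon_coeff (wave_A f1 f2) j = (if j < 0 then 0 else complex_of_real (fps_nth (F1 * F2) (nat j)))"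
  using horizon_coeff_affine[OF has_fps_expansion_mult[OF F1 F2], of "wave_A f1 f2" 0 1 j]
  by (simp add: wave_A_def)

lemma horizon_coeff_C:
  "horizon_coeff (wave_C f1 \<omega> \<mu>) j =
    (if j < 0 then 0 else (if j = 0 then \<omega>\<^sup>2 else 0) - \<mu> * complex_of_real (fps_nth F1 (nat j)))"
  using horizon_coeff_affine[OF F1, of "wave_C f1 \<omega> \<mu>" "\<omega>\<^sup>2" "-\<mu>" j]
  by (simp add: wave_C_def)

text \<open>The product f1 f2 starts at order two, so 1/z = 1 - h + ... is used only to first order.
  The fourth coefficient of f1 f2 stays symbolic because it cancels in the order-2
  determinant.\<close>

lemma horizon_coeff_B:
  "horizon_coeff (wave_B d f1 f2) 1 = complex_of_real (a1 * b1)"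
  "horizon_coeff (wave_B d f1 f2) 2 =
     complex_of_real (3 / 2 * (a1 * b2 + a2 * b1) - d * (a1 * b1))"
  "horizon_coeff (wave_B d f1 f2) 3 =
     complex_of_real (2 * fps_nth (F1 * F2) 4 - d * (a1 * b2 + a2 * b1 - a1 * b1))"
proof -
  define A where "A = F1 * F2"
  define I where "I = inverse (1 + fps_X :: real fps)"
  have "I * (1 + fps_X) = 1"
    unfolding I_def by (rule inverse_mult_eq_1) simp
  then have "fps_nth (I * (1 + fps_X)) 0 = 1" "fps_nth (I * (1 + fps_X)) 1 = 0"
    by simp_all
  then have I: "fps_nth I 0 = 1" "fps_nth I (Suc 0) = -1"
    by (simp_all add: algebra_simps)
  have "(\<lambda>h. (1/2) * deriv (\<lambda>h. f1 (1 + h) * f2 (1 + h)) h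
        - d * (inverse (1 + h) * (f1 (1 + h) * f2 (1 + h))))
      has_fps_expansion fps_const (1/2) * fps_deriv A - fps_const (real d) * (I * A)"
    unfolding A_def I_def by (intro fps_expansion_intros F1 F2) auto
  moreover have "wave_B d f1 f2 z = 0 + 1 * complex_of_real
      ((1/2) * deriv (\<lambda>h. f1 (1 + h) * f2 (1 + h)) (z - 1)
        - d * (inverse (1 + (z - 1)) * (f1 (1 + (z - 1)) * f2 (1 + (z - 1)))))" for z
    unfolding wave_B_def deriv_shift[of "\<lambda>y. f1 y * f2 y" z 1] by (simp add: inverse_eq_divide)
  ultimately have B: "horizon_coeff (wave_B d f1 f2) j =
     (if j < 0 then 0 else
       complex_of_real (fps_nth (fps_const (1/2) * fps_deriv A - fps_const (real d) * (I * A)) (nat j)))" for j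
    using horizon_coeff_affine[of _ _ "wave_B d f1 f2" 0 1 j] by simp
  note A = A_nth[folded A_def, unfolded numeral_2_eq_2 numeral_3_eq_3 One_nat_def]
  show "horizon_coeff (wave_B d f1 f2) 1 = complex_of_real (a1 * b1)"
    "horizon_coeff (wave_B d f1 f2) 2 =
       complex_of_real (3 / 2 * (a1 * b2 + a2 * b1) - d * (a1 * b1))"
    "horizon_coeff (wave_B d f1 f2) 3 =
       complex_of_real (2 * fps_nth A 4 - d * (a1 * b2 + a2 * b1 - a1 * b1))"
    unfolding B by (simp_all add: fps_mult_nth[of I] I A eval_nat_numeral)
qed

lemma at_pole_skipping_freq:
  "ingoing_exponent T (pole_skipping_freq T n) = - of_nat n / 2"
  "(pole_skipping_freq T n)\<^sup>2 = - complex_of_real (a1 * b1) * (of_nat n)\<^sup>2 / 4"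
  using T by (simp_all add: ingoing_exponent_def pole_skipping_freq_def power_mult_distrib field_simps)

text \<open>At \<rho> = -1/2 the cubic coefficient of f1 f2 enters with 3/4 from A and -3/4 from B,
  leaving only first-order horizon data.\<close>

lemma pole_skipping_det_1:
  "pole_skipping_det d f1 f2 T 1 \<mu> = complex_of_real a1 * (complex_of_real (d * b1 / 2) - \<mu>)"
proof -
  have "pole_skipping_det d f1 f2 T 1 \<mu> = frobenius_M d f1 f2 T (pole_skipping_freq T 1) \<mu> 1 1"
    unfolding pole_skipping_det_def by (subst det_single) auto
  also have "\<dots> = complex_of_real a1 * (complex_of_real (d * b1 / 2) - \<mu>)"
    unfolding frobenius_M_def Let_def at_pole_skipping_freq
    by (simp add: horizon_coeff_A horizon_coeff_B horizon_coeff_C A_nth, simp add: field_simps)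
  finally show ?thesis .
qed

text \<open>At \<rho> = -1 the factor \<rho> + S - 1 vanishes for S = 2, so the second column
  contains only coefficients of C.\<close>

lemma pole_skipping_det_2:
  fixes \<mu> :: complex
  shows "pole_skipping_det d f1 f2 T 2 \<mu> =
     (complex_of_real ((a1 * b2 + a2 * b1) / 2 + d * a1 * b1) - \<mu> * a1) * (- \<mu> * a1)
     + complex_of_real (a1 * b1) * (complex_of_real (d * (a1 * b2 + a2 * b1 - a1 * b1)) - \<mu> * a2)"
proof -
  let ?M = "frobenius_M d f1 f2 T (pole_skipping_freq T 2) \<mu>"
  have "pole_skipping_det d f1 f2 T 2 \<mu> = ?M 1 1 * ?M 2 2 - ?M 1 2 * ?M 2 1"
    unfolding pole_skipping_det_def by (subst det_two) (auto simp: numeral_2_eq_2)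
  moreover have "?M 1 1 = complex_of_real ((a1 * b2 + a2 * b1) / 2 + d * a1 * b1) - \<mu> * a1"
    "?M 1 2 = - complex_of_real (a1 * b1)"
    "?M 2 1 = complex_of_real (d * (a1 * b2 + a2 * b1 - a1 * b1)) - \<mu> * a2"
    "?M 2 2 = - \<mu> * a1"
    unfolding frobenius_M_def Let_def at_pole_skipping_freq
    by (simp_all add: horizon_coeff_A horizon_coeff_B horizon_coeff_C A_nth horizon at_pole_skipping_freq, simp_all add: field_simps)
  ultimately show ?thesis by simp
qed

lemma a1_nonzero: "a1 \<noteq> 0"
  using T by auto

lemma order_1_value:
  assumes "pole_skipping_values d f1 f2 T 1 {#\<mu>11#}"
  shows "\<mu>11 = complex_of_real (d * b1 / 2)"
proof -
  from assms obtain P where P: "\<And>\<mu>. poly P \<mu> = pole_skipping_det d f1 f2 T 1 \<mu>" "proots P = {#\<mu>11#}"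
    unfolding pole_skipping_values_def by blast
  have "pole_skipping_det d f1 f2 T 1 \<mu>11 = 0"
    using poly_eq_prod_proots[of P \<mu>11] P by simp
  then show ?thesis
    using a1_nonzero by (simp add: pole_skipping_det_1[unfolded One_nat_def])
qed

text \<open>The factored form gives the product (2 \<mu>11 - \<mu>21)(2 \<mu>11 - \<mu>22) by a
  single evaluation, without solving the quadratic.\<close>

lemma order_2_det:
  assumes "pole_skipping_values d f1 f2 T 2 {#\<mu>21, \<mu>22#}"
  shows "pole_skipping_det d f1 f2 T 2 \<mu> = complex_of_real (a1\<^sup>2) * (\<mu> - \<mu>21) * (\<mu> - \<mu>22)"
proof -
  let ?D = "pole_skipping_det d f1 f2 T 2"
  from assms obtain P where P: "\<And>\<mu>. poly P \<mu> = ?D \<mu>" "proots P = {#\<mu>21, \<mu>22#}"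
    unfolding pole_skipping_values_def by blast
  have D: "?D \<mu> = lead_coeff P * (\<mu> - \<mu>21) * (\<mu> - \<mu>22)" for \<mu>
    using poly_eq_prod_proots[of P \<mu>] P by simp
  \<comment> \<open>A second difference reads off the leading coefficient.\<close>
  have "?D 1 + ?D (-1) - 2 * ?D 0 = 2 * lead_coeff P"
    unfolding D by (simp add: algebra_simps)
  moreover have "?D 1 + ?D (-1) - 2 * ?D 0 = 2 * complex_of_real (a1\<^sup>2)"
    unfolding pole_skipping_det_2 by (simp add: field_simps power2_eq_square)
  ultimately show ?thesis using D by simp
qed

text \<open>The product of differences leaves -(d b1)^2 after multiplication by d, which 4 \<mu>11^2
  cancels exactly. The result is real even if \<mu>21 and \<mu>22 are not.\<close>

lemma pole_skipping_combination:
  assumes "pole_skipping_values d f1 f2 T 1 {#\<mu>11#}"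
    and "pole_skipping_values d f1 f2 T 2 {#\<mu>21, \<mu>22#}"
  shows "4 * \<mu>11\<^sup>2 + of_nat d * (2 * \<mu>11 - \<mu>21) * (2 * \<mu>11 - \<mu>22)
    = complex_of_real ((real d)\<^sup>2 * (a1 * b1) * (a1 * b2 - a2 * b1) / (2 * a1\<^sup>2))"
proof -
  note \<mu>11 = order_1_value[OF assms(1)]
  have "complex_of_real (a1\<^sup>2) * (2 * \<mu>11 - \<mu>21) * (2 * \<mu>11 - \<mu>22)
      = pole_skipping_det d f1 f2 T 2 (2 * \<mu>11)"
    by (simp only: order_2_det[OF assms(2)])
  also have "\<dots> = complex_of_real (d * (a1 * b1) * ((a1 * b2 - a2 * b1) / 2 - a1 * b1))"
    unfolding pole_skipping_det_2 \<mu>11 by (simp add: field_simps)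
  finally have det: "complex_of_real (a1\<^sup>2) * (2 * \<mu>11 - \<mu>21) * (2 * \<mu>11 - \<mu>22)
      = complex_of_real (d * (a1 * b1) * ((a1 * b2 - a2 * b1) / 2 - a1 * b1))" .
  have "x * y = complex_of_real (r / s)" if "complex_of_real s * x * y = complex_of_real r" "s \<noteq> 0" for r s x y
    using that by (simp add: field_simps)
  from this[OF det] have product: "(2 * \<mu>11 - \<mu>21) * (2 * \<mu>11 - \<mu>22)
      = complex_of_real (d * (a1 * b1) * ((a1 * b2 - a2 * b1) / 2 - a1 * b1) / a1\<^sup>2)"
    using a1_nonzero by simp
  have square: "4 * \<mu>11\<^sup>2 = complex_of_real ((d * b1)\<^sup>2)"
    by (simp add: \<mu>11 power_divide power_mult_distrib)
  have "4 * \<mu>11\<^sup>2 + of_nat d * (2 * \<mu>11 - \<mu>21) * (2 * \<mu>11 - \<mu>22)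
      = complex_of_real ((d * b1)\<^sup>2 + d * (d * (a1 * b1) * ((a1 * b2 - a2 * b1) / 2 - a1 * b1) / a1\<^sup>2))"
    unfolding mult.assoc[of "of_nat d"] product square by simp
  also have "(d * b1)\<^sup>2 + d * (d * (a1 * b1) * ((a1 * b2 - a2 * b1) / 2 - a1 * b1) / a1\<^sup>2)
      = (real d)\<^sup>2 * (a1 * b1) * (a1 * b2 - a2 * b1) / (2 * a1\<^sup>2)"
    using a1_nonzero by (simp add: field_simps power2_eq_square)
  finally show ?thesis .
qed

end

section \<open>The pole-skipping inequality\<close>

theorem mainTheorem7:
  fixes f1 f2 :: "real \<Rightarrow> real"
    and z0 T \<Lambda> G\<^sub>N :: real
    and Tmn :: "real ^ ('d::finite coord) \<Rightarrow> real ^ ('d coord) ^ ('d coord)"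
    and \<mu>11 \<mu>21 \<mu>22 :: complex
  assumes z0: "0 \<le> z0" "z0 < 1"
    and static_exterior: "\<And>z. z0 < z \<Longrightarrow> z < 1 \<Longrightarrow> f1 z > 0 \<and> f2 z > 0"
    and analytic: "real_analytic_at f1 1" "real_analytic_at f2 1"
    and horizon: "f1 1 = 0" "f2 1 = 0"
    and temperature: "T > 0" "deriv f1 1 * deriv f2 1 = (4 * pi * T)\<^sup>2"
    and newton: "G\<^sub>N > 0"
    and einstein: "einstein_equations_on (exterior z0) (planar_metric f1 f2) \<Lambda> G\<^sub>N Tmn"
    and nec: "null_energy_condition_on (exterior z0) (planar_metric f1 f2) Tmn"
    and order1: "pole_skipping_values CARD('d) f1 f2 T 1 {#\<mu>11#}"
    and order2: "pole_skipping_values CARD('d) f1 f2 T 2 {#\<mu>21, \<mu>22#}"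
  shows "4 * \<mu>11\<^sup>2 + of_nat CARD('d) * (2 * \<mu>11 - \<mu>21) * (2 * \<mu>11 - \<mu>22) \<in> \<real>\<^sub>\<ge>\<^sub>0"
proof -
  obtain F1 F2 where F: "(\<lambda>h. f1 (1 + h)) has_fps_expansion F1" "(\<lambda>h. f2 (1 + h)) has_fps_expansion F2"
    using analytic by (elim real_analytic_at_imp_has_fps_expansion)
  have shift: "deriv (\<lambda>h. f (1 + h)) = (\<lambda>h. deriv f (1 + h))" for f :: "real \<Rightarrow> real"
    using deriv_shift[of f _ 1] by (metis add_diff_cancel_left')
  have F': "(\<lambda>h. deriv f1 (1 + h)) has_fps_expansion fps_deriv F1"
    "(\<lambda>h. deriv f2 (1 + h)) has_fps_expansion fps_deriv F2"
    using F[THEN has_fps_expansion_deriv] by (simp_all add: shift)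
  have F_nth: "fps_nth F1 0 = 0" "fps_nth F2 0 = 0" "fps_nth F1 1 = deriv f1 1" "fps_nth F2 1 = deriv f2 1"
    using F[THEN has_fps_expansion_at_0] F'[THEN has_fps_expansion_at_0] horizon by simp_all
  interpret horizon_expansion "CARD('d)" f1 f2 F1 F2 T
    by standard (use F F_nth temperature in auto)

  have "eventually (\<lambda>z. (f1 has_real_derivative deriv f1 z) (at z)
      \<and> (deriv f1 has_real_derivative deriv (deriv f1) z) (at z)
      \<and> (f2 has_real_derivative deriv f2 z) (at z)) (nhds 1)"
    using F F'(1) by (intro eventually_conj) (rule eventually_differentiable_near, assumption)+
  then obtain U where U: "open U" "1 \<in> U"
    and diff: "\<And>z. z \<in> U \<Longrightarrow> (f1 has_real_derivative deriv f1 z) (at z)"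
      "\<And>z. z \<in> U \<Longrightarrow> (deriv f1 has_real_derivative deriv (deriv f1) z) (at z)"
      "\<And>z. z \<in> U \<Longrightarrow> (f2 has_real_derivative deriv f2 z) (at z)"
    unfolding eventually_nhds by blast
  \<comment> \<open>Near the horizon, but strictly outside it: analyticity gives derivatives on
    \<open>U\<close>, and f1, f2 are positive for z0 < z < 1.\<close>
  define S where "S = U \<inter> {z0<..<1}"
  have "eventually (\<lambda>h. 1 + h \<in> U \<inter> {z0<..}) (nhds 0)"
    using U z0 eventually_nhds_in_open[of "U \<inter> {z0<..}" 1] eventually_nhds_shift[of "\<lambda>z. z \<in> U \<inter> {z0<..}" 0 "-1"]
    by (simp add: open_Int add.commute)
  then have near: "eventually (\<lambda>h. 1 + h \<in> S) (at_left 0)"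
    unfolding eventually_at_filter by eventually_elim (auto simp: S_def)

  define w where "w h = deriv f2 (1 + h) * f1 (1 + h) - deriv f1 (1 + h) * f2 (1 + h)" for h
  have W: "w has_fps_expansion fps_deriv F2 * F1 - fps_deriv F1 * F2" (is "_ has_fps_expansion ?W")
    unfolding w_def by (intro fps_expansion_intros F F')
  \<comment> \<open>Order 0 vanishes by the horizon conditions, and order 1 is b1 a1 - a1
    b1.\<close>
  have W_low: "fps_nth ?W i = 0" if "i < 2" for i
    using that F_nth by (auto simp: less_2_cases_iff)
  have "w h \<ge> 0" if "1 + h \<in> S" for h
  proof -
    have "deriv f1 (1 + h) * f2 (1 + h) \<le> deriv f2 (1 + h) * f1 (1 + h)"
      by (rule planar_radial_nec[OF z0(1) _ _ _ _ diff newton einstein nec that])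
         (use U static_exterior in \<open>auto simp: S_def\<close>)
    then show ?thesis by (simp add: w_def)
  qed
  then have "eventually (\<lambda>h. w h \<ge> 0) (at_left 0)"
    using near by (auto elim: eventually_mono)
  then have "fps_nth ?W 2 \<ge> 0"
    by (intro leading_even_coeff_nonneg[OF W W_low]) auto
  \<comment> \<open>The second coefficient is (2 b2 a1 + b1 a2) - (2 a2 b1 + a1 b2).\<close>
  then have "a1 * b2 - a2 * b1 \<ge> 0"
    using F_nth by (simp add: fps_mult_nth numeral_2_eq_2 numeral_3_eq_3 mult.commute)
  moreover have "a1 * b1 \<ge> 0"
    using T by simp
  ultimately have "(real CARD('d))\<^sup>2 * (a1 * b1) * (a1 * b2 - a2 * b1) / (2 * a1\<^sup>2) \<ge> 0"
    by (intro divide_nonneg_nonneg mult_nonneg_nonneg[OF mult_nonneg_nonneg]) auto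
  then show ?thesis
    unfolding pole_skipping_combination[OF order1 order2] by (simp only: nonneg_Reals_of_real_iff)
qed

end
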